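(* Let $d\ge 3$ be odd, let $k>2$ be an integer and let $V=(\mathbb{C}^k)^{\otimes d}$. Then it is not the case that for every integer $n\in[0,k^d-k]$ the linear map $$L:\bigwedge^n V\longrightarrow\bigwedge^{n+k}V,\qquad L(v)=\omega\wedge v,$$ has full rank; that is, there is an integer $n\in[0,k^d-k]$ for which $L:\bigwedge^n V\to\bigwedge^{n+k}V$ is neither injective nor surjective.
   Context: The Cayley form is $$\omega=\omega_{d,k}=\sum_{\pi_1,\ldots,\pi_d\in S_k}\mathrm{sgn}(\pi_1\cdots\pi_d)\bigwedge_{i=1}^k \left(e_{\pi_1(i)}\otimes\cdots\otimes e_{\pi_d(i)}\right)\in\bigwedge^k V,$$ where $e_1,\ldots,e_k$ is the standard basis of $\mathbb{C}^k$. *)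

theory Defs
  imports Complex_Main "HOL-Combinatorics.Permutations"
    "HOL-Library.Function_Algebras" "HOL-Library.FuncSet" "HOL-Library.List_Lexorder"
begin

section \<open>Spaces of complex-valued functions\<close>

definition fscale :: "complex \<Rightarrow> ('a \<Rightarrow> complex) \<Rightarrow> 'a \<Rightarrow> complex" where
  "fscale c f = (\<lambda>x. c * f x)"

interpretation cfun: vector_space "fscale :: complex \<Rightarrow> ('a \<Rightarrow> complex) \<Rightarrow> 'a \<Rightarrow> complex"
  by unfold_locales (auto simp: fscale_def fun_eq_iff algebra_simps)

definition fun_space :: "'a set \<Rightarrow> ('a \<Rightarrow> complex) set" where
  "fun_space B = {v. \<forall>b. b \<notin> B \<longrightarrow> v b = 0}"

definition unit_fun :: "'a \<Rightarrow> 'a \<Rightarrow> complex" where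
  "unit_fun b = (\<lambda>c. if c = b then 1 else 0)"

text \<open>Used for a linear map \<open>f\<close> and finite-dimensional spaces \<open>U\<close>, \<open>W\<close> with
  \<open>f ` U \<subseteq> W\<close>.\<close>

definition full_rank :: "(('a \<Rightarrow> complex) \<Rightarrow> ('b \<Rightarrow> complex)) \<Rightarrow>
    ('a \<Rightarrow> complex) set \<Rightarrow> ('b \<Rightarrow> complex) set \<Rightarrow> bool" where
  "full_rank f U W \<longleftrightarrow> cfun.dim (f ` U) = min (cfun.dim U) (cfun.dim W)"


section \<open>The tensor power of \<open>\<complex>\<^sup>k\<close>\<close>

text \<open>A tensor of order \<open>d\<close> is given by its array of coordinates, indexed by the lists
  \<open>[i\<^sub>1, \<dots>, i\<^sub>d]\<close> with \<open>1 \<le> i\<^sub>j \<le> k\<close>; the array of \<open>v\<^sub>1 \<otimes> \<dots> \<otimes> v\<^sub>d\<close> has the entries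
  \<open>v\<^sub>1(i\<^sub>1) \<cdots> v\<^sub>d(i\<^sub>d)\<close>.  The vectors of \<open>\<complex>\<^sup>k\<close> are the elements of \<open>fun_space {1..k}\<close>, with
  standard basis \<open>unit_fun 1, \<dots>, unit_fun k\<close>.\<close>

definition tensor :: "(nat \<Rightarrow> complex) list \<Rightarrow> nat list \<Rightarrow> complex" where
  "tensor vs = (\<lambda>is. if length is = length vs then \<Prod>j<length vs. (vs ! j) (is ! j) else 0)"

definition tensor_power :: "nat \<Rightarrow> nat \<Rightarrow> (nat list \<Rightarrow> complex) set" where
  "tensor_power d k = cfun.span {tensor vs | vs. length vs = d \<and> set vs \<subseteq> fun_space {1..k}}"


section \<open>The exterior algebra\<close>

text \<open>Let \<open>'b\<close> be a linearly ordered type.  An element \<open>u :: 'b set \<Rightarrow> complex\<close> stands for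
  \<open>\<Sum>\<^sub>S u(S) e\<^sub>S\<close>, where \<open>e\<^sub>S = e\<^bsub>s\<^sub>1\<^esub> \<and> \<dots> \<and> e\<^bsub>s\<^sub>m\<^esub>\<close> for a finite set \<open>S = {s\<^sub>1 < \<dots> < s\<^sub>m}\<close>.
  The product is determined by
  \<open>e\<^sub>S \<and> e\<^sub>T = wedge_sign S T \<cdot> e\<^bsub>S \<union> T\<^esub>\<close> for disjoint \<open>S\<close>, \<open>T\<close>, and \<open>e\<^sub>S \<and> e\<^sub>T = 0\<close> otherwise;
  the sign is that of the permutation which sorts the concatenation of \<open>S\<close> and \<open>T\<close>.  The order
  serves only to fix the signs of the basis elements \<open>e\<^sub>S\<close>.\<close>

definition wedge_sign :: "'b::linorder set \<Rightarrow> 'b set \<Rightarrow> complex" where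
  "wedge_sign S T = (- 1) ^ card {(s, t). s \<in> S \<and> t \<in> T \<and> t < s}"

definition wedge :: "('b::linorder set \<Rightarrow> complex) \<Rightarrow> ('b set \<Rightarrow> complex) \<Rightarrow> 'b set \<Rightarrow> complex"
    (infixr \<open>\<and>\<^sub>e\<close> 70) where
  "u \<and>\<^sub>e v = (\<lambda>S. \<Sum>T\<in>Pow S. wedge_sign T (S - T) * u T * v (S - T))"

definition ext_vec :: "('b \<Rightarrow> complex) \<Rightarrow> 'b set \<Rightarrow> complex" where
  "ext_vec x = (\<lambda>S. if is_singleton S then x (the_elem S) else 0)"

definition wedge_list :: "('b::linorder \<Rightarrow> complex) list \<Rightarrow> 'b set \<Rightarrow> complex" where
  "wedge_list xs = foldr (\<lambda>x u. ext_vec x \<and>\<^sub>e u) xs (unit_fun {})"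

definition ext_power :: "nat \<Rightarrow> ('b::linorder \<Rightarrow> complex) set \<Rightarrow> ('b set \<Rightarrow> complex) set" where
  "ext_power n V = cfun.span {wedge_list xs | xs. length xs = n \<and> set xs \<subseteq> V}"


section \<open>The Cayley form\<close>

definition cayley_form :: "nat \<Rightarrow> nat \<Rightarrow> nat list set \<Rightarrow> complex" where
  "cayley_form d k = (\<Sum>\<pi> \<in> {1..d} \<rightarrow>\<^sub>E {p. p permutes {1..k}}.
     fscale (of_int (sign (foldr (\<circ>) (map \<pi> [1..<Suc d]) id)))
       (wedge_list (map (\<lambda>i. tensor (map (\<lambda>j. unit_fun (\<pi> j i)) [1..<Suc d])) [1..<Suc k])))"


section \<open>Basic properties of the model\<close>

subsection \<open>Bases\<close>

lemma sum_fun_apply: "(\<Sum>i\<in>I. f i) x = (\<Sum>i\<in>I. (f i :: 'a \<Rightarrow> complex) x)"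
  by (induction I rule: infinite_finite_induct) auto

lemma subspace_fun_space: "cfun.subspace (fun_space B)"
  by (auto simp: cfun.subspace_def fun_space_def fscale_def)

lemma span_unit_fun:
  assumes "finite B"
  shows "cfun.span (unit_fun ` B) = fun_space B"
proof
  show "cfun.span (unit_fun ` B) \<subseteq> fun_space B"
    by (rule cfun.span_minimal[OF _ subspace_fun_space]) (auto simp: fun_space_def unit_fun_def)
next
  show "fun_space B \<subseteq> cfun.span (unit_fun ` B)"
  proof
    fix v :: "'a \<Rightarrow> complex" assume v: "v \<in> fun_space B"
    have "v = (\<Sum>b\<in>B. fscale (v b) (unit_fun b))"
    proof
      fix x
      have "(\<Sum>b\<in>B. fscale (v b) (unit_fun b)) x = (\<Sum>b\<in>B. if b = x then v b else 0)"
        unfolding sum_fun_apply by (rule sum.cong) (auto simp: fscale_def unit_fun_def)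
      also have "\<dots> = v x" using v assms by (auto simp: fun_space_def)
      finally show "v x = (\<Sum>b\<in>B. fscale (v b) (unit_fun b)) x" ..
    qed
    also have "\<dots> \<in> cfun.span (unit_fun ` B)"
      by (intro cfun.span_sum cfun.span_scale cfun.span_base) auto
    finally show "v \<in> cfun.span (unit_fun ` B)" .
  qed
qed

definition multi_index :: "nat \<Rightarrow> nat \<Rightarrow> nat list set" where
  "multi_index d k = {is. set is \<subseteq> {1..k} \<and> length is = d}"

lemma finite_multi_index: "finite (multi_index d k)"
  unfolding multi_index_def by (rule finite_lists_length_eq) simp

lemma card_multi_index: "card (multi_index d k) = k ^ d"
  unfolding multi_index_def by (subst card_lists_length_eq) auto

lemma tensor_unit_fun: "tensor (map unit_fun is) = unit_fun is"
proof
  fix js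
  show "tensor (map unit_fun is) js = unit_fun is js"
  proof (cases "js = is")
    case True
    then show ?thesis by (simp add: tensor_def unit_fun_def)
  next
    case False
    show ?thesis
    proof (cases "length js = length is")
      case True
      with False obtain j where "j < length is" "js ! j \<noteq> is ! j"
        by (auto simp: list_eq_iff_nth_eq)
      then show ?thesis using False True by (auto simp: tensor_def unit_fun_def)
    qed (use False in \<open>auto simp: tensor_def unit_fun_def\<close>)
  qed
qed

lemma tensor_power_eq: "tensor_power d k = fun_space (multi_index d k)"
proof
  show "tensor_power d k \<subseteq> fun_space (multi_index d k)"
    unfolding tensor_power_def
  proof (rule cfun.span_minimal[OF _ subspace_fun_space], clarify)
    fix vs :: "(nat \<Rightarrow> complex) list"
    assume d: "d = length vs" and vs: "set vs \<subseteq> fun_space {1..k}"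
    show "tensor vs \<in> fun_space (multi_index (length vs) k)"
      unfolding fun_space_def mem_Collect_eq
    proof (intro allI impI)
      fix "is" assume "is \<notin> multi_index (length vs) k"
      then have "length is \<noteq> length vs \<or> (\<exists>j < length vs. is ! j \<notin> {1..k})"
        unfolding multi_index_def by (metis (mono_tags, lifting) in_set_conv_nth mem_Collect_eq subsetI)
      then consider "length is \<noteq> length vs"
        | j where "length is = length vs" "j < length vs" "is ! j \<notin> {1..k}"
        by blast
      then show "tensor vs is = 0"
      proof cases
        case 2
        then have "(vs ! j) (is ! j) = 0"
          using vs nth_mem[of j vs] unfolding fun_space_def by blast
        with 2 show ?thesis by (auto simp: tensor_def)
      qed (simp add: tensor_def)
    qed
  qed
next
  have "unit_fun ` multi_index d k \<subseteq> {tensor vs | vs. length vs = d \<and> set vs \<subseteq> fun_space {1..k}}"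
  proof clarify
    fix "is" assume "is \<in> multi_index d k"
    then show "\<exists>vs. unit_fun is = tensor vs \<and> length vs = d \<and> set vs \<subseteq> fun_space {1..k}"
      by (intro exI[of _ "map unit_fun is"])
        (auto simp: tensor_unit_fun multi_index_def fun_space_def unit_fun_def)
  qed
  then show "fun_space (multi_index d k) \<subseteq> tensor_power d k"
    unfolding tensor_power_def span_unit_fun[OF finite_multi_index, symmetric]
    by (rule cfun.span_mono)
qed

lemma ext_vec_singleton [simp]: "ext_vec x {b} = x b"
  by (simp add: ext_vec_def)

lemma ext_vec_eq_0: "(\<And>b. S \<noteq> {b}) \<Longrightarrow> ext_vec x S = 0"
  by (auto simp: ext_vec_def is_singleton_def)

lemma wedge_infinite: "infinite S \<Longrightarrow> (u \<and>\<^sub>e v) S = 0"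
  by (simp add: wedge_def)

lemma ext_vec_wedge:
  assumes "finite S"
  shows "(ext_vec x \<and>\<^sub>e u) S = (\<Sum>b\<in>S. wedge_sign {b} (S - {b}) * x b * u (S - {b}))"
proof -
  have "(ext_vec x \<and>\<^sub>e u) S
      = (\<Sum>T\<in>(\<lambda>b. {b}) ` S. wedge_sign T (S - T) * ext_vec x T * u (S - T))"
    unfolding wedge_def using assms
    by (intro sum.mono_neutral_right) (auto intro!: ext_vec_eq_0)
  also have "\<dots> = (\<Sum>b\<in>S. wedge_sign {b} (S - {b}) * x b * u (S - {b}))"
    by (subst sum.reindex) (auto simp: inj_on_def)
  finally show ?thesis .
qed

lemma wedge_list_unit_fun:
  assumes "sorted bs" "distinct bs"
  shows "wedge_list (map unit_fun bs) = unit_fun (set bs)"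
  using assms
proof (induction bs)
  case Nil
  then show ?case by (simp add: wedge_list_def)
next
  case (Cons a bs)
  then have IH: "wedge_list (map unit_fun bs) = unit_fun (set bs)"
    and less: "\<And>b. b \<in> set bs \<Longrightarrow> a < b" and a: "a \<notin> set bs" 
    by (auto simp: less_le)
  have eq: "wedge_list (map unit_fun (a # bs)) = ext_vec (unit_fun a) \<and>\<^sub>e unit_fun (set bs)"
    by (simp add: IH[symmetric] wedge_list_def)
  show ?case
  proof
    fix S
    show "wedge_list (map unit_fun (a # bs)) S = unit_fun (set (a # bs)) S"
    proof (cases "finite S")
      case True
      have "(ext_vec (unit_fun a) \<and>\<^sub>e unit_fun (set bs)) S
          = (\<Sum>b\<in>S. if b = a then wedge_sign {a} (S - {a}) * unit_fun (set bs) (S - {a}) else 0)"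
        unfolding ext_vec_wedge[OF True] by (rule sum.cong) (auto simp: unit_fun_def)
      also have "\<dots> = (if a \<in> S then wedge_sign {a} (S - {a}) * unit_fun (set bs) (S - {a}) else 0)"
        using True by simp
      also have "\<dots> = unit_fun (set (a # bs)) S"
      proof (cases "S = insert a (set bs)")
        case True
        then have "{(s, t). s \<in> {a} \<and> t \<in> S - {a} \<and> t < s} = {}"
          using less by fastforce
        then have "wedge_sign {a} (S - {a}) = 1" 
          unfolding wedge_sign_def by (simp only: card.empty power_0)
        then show ?thesis using True a by (simp add: unit_fun_def)
      next
        case False
        then have "a \<in> S \<Longrightarrow> S - {a} \<noteq> set bs" by blast
        then show ?thesis using False by (simp add: unit_fun_def)
      qed
      finally show ?thesis unfolding eq .
    next
      case False
      then have "S \<noteq> set (a # bs)" by auto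
      then show ?thesis using False unfolding eq by (simp add: wedge_infinite unit_fun_def)
    qed
  qed
qed

lemma wedge_list_in:
  "set xs \<subseteq> fun_space B \<Longrightarrow> wedge_list xs \<in> fun_space {S. S \<subseteq> B \<and> finite S \<and> card S = length xs}"
proof (induction xs)
  case Nil
  then show ?case by (simp add: wedge_list_def fun_space_def unit_fun_def)
next
  case (Cons x xs)
  then have IH: "wedge_list xs \<in> fun_space {S. S \<subseteq> B \<and> finite S \<and> card S = length xs}"
    and x: "x \<in> fun_space B" by auto
  have eq: "wedge_list (x # xs) = ext_vec x \<and>\<^sub>e wedge_list xs"
    by (simp add: wedge_list_def)
  show ?case unfolding eq fun_space_def mem_Collect_eq
  proof (intro allI impI)
    fix S assume S: "\<not> (S \<subseteq> B \<and> finite S \<and> card S = length (x # xs))"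
    show "(ext_vec x \<and>\<^sub>e wedge_list xs) S = 0"
    proof (cases "finite S")
      case True
      have "x b = 0 \<or> wedge_list xs (S - {b}) = 0" if b: "b \<in> S" for b
      proof (rule ccontr)
        assume *: "\<not> ?thesis"
        then have "b \<in> B" using x by (auto simp: fun_space_def)
        moreover have "S - {b} \<subseteq> B" "card (S - {b}) = length xs"
          using IH * unfolding fun_space_def by blast+
        moreover have "card S = Suc (card (S - {b}))"
          using True b by (simp only: card.remove)
        moreover have "S = insert b (S - {b})" using b by auto
        ultimately have "S \<subseteq> B" "card S = length (x # xs)" by (blast, simp)
        then show False using S True by blast
      qed
      then show ?thesis unfolding ext_vec_wedge[OF True] by (intro sum.neutral) auto
    qed (simp add: wedge_infinite)
  qed
qed

text \<open>The elements \<open>e\<^sub>S\<close> with \<open>S \<subseteq> B\<close> and \<open>|S| = n\<close> form a basis of the \<open>n\<close>-th exterior power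
  of the space with basis \<open>B\<close>.\<close>

lemma ext_power_eq:
  assumes "finite B"
  shows "ext_power n (fun_space B) = fun_space {S. S \<subseteq> B \<and> card S = n}"
proof -
  have fin: "finite {S. S \<subseteq> B \<and> card S = n}" 
    by (rule finite_subset[of _ "Pow B"]) (use assms in auto)
  have *: "{S. S \<subseteq> B \<and> finite S \<and> card S = n} = {S. S \<subseteq> B \<and> card S = n}"
    using assms by (auto intro: finite_subset)
  show ?thesis
  proof
    show "ext_power n (fun_space B) \<subseteq> fun_space {S. S \<subseteq> B \<and> card S = n}"
      unfolding ext_power_def
    proof (rule cfun.span_minimal[OF _ subspace_fun_space], clarify)
      fix xs :: "('a \<Rightarrow> complex) list"
      assume "n = length xs" and "set xs \<subseteq> fun_space B"
      then show "wedge_list xs \<in> fun_space {S. S \<subseteq> B \<and> card S = length xs}"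
        using wedge_list_in[of xs B] * by simp
    qed
  next
    have "unit_fun ` {S. S \<subseteq> B \<and> card S = n}
        \<subseteq> {wedge_list xs | xs. length xs = n \<and> set xs \<subseteq> fun_space B}"
    proof clarify
      fix S assume S: "S \<subseteq> B" and n: "n = card S"
      then have "finite S" using assms finite_subset by blast
      then show "\<exists>xs. unit_fun S = wedge_list xs \<and> length xs = card S \<and> set xs \<subseteq> fun_space B"
        using S by (intro exI[of _ "map unit_fun (sorted_list_of_set S)"])
          (auto simp: wedge_list_unit_fun fun_space_def unit_fun_def)
    qed
    then show "fun_space {S. S \<subseteq> B \<and> card S = n} \<subseteq> ext_power n (fun_space B)"
      unfolding ext_power_def span_unit_fun[OF fin, symmetric] by (rule cfun.span_mono)
  qed
qed


subsection \<open>Algebra laws\<close>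

lemma wedge_add_left: "(u + v) \<and>\<^sub>e w = u \<and>\<^sub>e w + v \<and>\<^sub>e w"
  by (auto simp: wedge_def fun_eq_iff algebra_simps sum.distrib)

lemma wedge_add_right: "u \<and>\<^sub>e (v + w) = u \<and>\<^sub>e v + u \<and>\<^sub>e w"
  by (auto simp: wedge_def fun_eq_iff algebra_simps sum.distrib)

lemma wedge_scale_left: "fscale c u \<and>\<^sub>e w = fscale c (u \<and>\<^sub>e w)"
  by (auto simp: wedge_def fun_eq_iff fscale_def sum_distrib_left mult_ac)

lemma wedge_scale_right: "u \<and>\<^sub>e fscale c w = fscale c (u \<and>\<^sub>e w)"
  by (auto simp: wedge_def fun_eq_iff fscale_def sum_distrib_left mult_ac)

lemma ext_vec_square: "ext_vec x \<and>\<^sub>e ext_vec x = (\<lambda>_. 0)"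
proof
  fix S
  show "(ext_vec x \<and>\<^sub>e ext_vec x) S = 0"
  proof (cases "\<exists>a b. a < b \<and> S = {a, b}")
    case True
    then obtain a b where ab: "a < b" and S: "S = {a, b}" by blast
    have d: "S - {a} = {b}" "S - {b} = {a}" using ab S by auto
    have 0: "{(s, t). s \<in> {a} \<and> t \<in> {b} \<and> t < s} = {}"
      and 1: "{(s, t). s \<in> {b} \<and> t \<in> {a} \<and> t < s} = {(b, a)}" using ab by auto
    have "wedge_sign {a} {b} = 1" "wedge_sign {b} {a} = - 1"
      unfolding wedge_sign_def 0 1 by simp_all
    moreover have "finite S" using S by simp
    ultimately show ?thesis
      using ab S d by (simp add: ext_vec_wedge) 
  next
    case False
    have "ext_vec x (S - {b}) = 0" if "b \<in> S" for b
    proof (rule ext_vec_eq_0, rule notI)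
      fix a assume "S - {b} = {a}"
      then have "S = {a, b}" "S = {b, a}" "a \<noteq> b" using that by auto
      then show False using False by (metis linorder_less_linear)
    qed
    then show ?thesis
      by (cases "finite S") (auto simp: ext_vec_wedge wedge_infinite)
  qed
qed

lemma wedge_sign_Un_left:
  assumes "finite R" "finite S" "finite T" "R \<inter> S = {}"
  shows "wedge_sign (R \<union> S) T = wedge_sign R T * wedge_sign S T"
proof -
  let ?P = "\<lambda>A. {(s, t). s \<in> A \<and> t \<in> T \<and> t < s}"
  have "?P (R \<union> S) = ?P R \<union> ?P S" "?P R \<inter> ?P S = {}" using assms(4) by auto
  moreover have "finite (?P R)" "finite (?P S)"
    by (rule finite_subset[of _ "R \<times> T"] finite_subset[of _ "S \<times> T"]; use assms in auto)+
  ultimately have "card (?P (R \<union> S)) = card (?P R) + card (?P S)"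
    by (simp only: card_Un_disjoint)
  then show ?thesis by (simp only: wedge_sign_def power_add)
qed

lemma wedge_sign_Un_right:
  assumes "finite R" "finite S" "finite T" "S \<inter> T = {}"
  shows "wedge_sign R (S \<union> T) = wedge_sign R S * wedge_sign R T"
proof -
  let ?P = "\<lambda>A. {(s, t). s \<in> R \<and> t \<in> A \<and> t < s}"
  have "?P (S \<union> T) = ?P S \<union> ?P T" "?P S \<inter> ?P T = {}" using assms(4) by auto
  moreover have "finite (?P S)" "finite (?P T)"
    by (rule finite_subset[of _ "R \<times> S"] finite_subset[of _ "R \<times> T"]; use assms in auto)+
  ultimately have "card (?P (S \<union> T)) = card (?P S) + card (?P T)"
    by (simp only: card_Un_disjoint)
  then show ?thesis by (simp only: wedge_sign_def power_add)
qed

lemma wedge_assoc: "(u \<and>\<^sub>e v) \<and>\<^sub>e w = u \<and>\<^sub>e (v \<and>\<^sub>e w)"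
proof
  fix S
  show "((u \<and>\<^sub>e v) \<and>\<^sub>e w) S = (u \<and>\<^sub>e (v \<and>\<^sub>e w)) S"
  proof (cases "finite S")
    case True
    then have fin: "finite T" if "T \<subseteq> S" for T using that finite_subset by blast
    let ?f = "\<lambda>R Q P. wedge_sign R Q * wedge_sign R P * wedge_sign Q P * u R * v Q * w P"
    have "((u \<and>\<^sub>e v) \<and>\<^sub>e w) S = (\<Sum>T\<in>Pow S. \<Sum>R\<in>Pow T. ?f R (T - R) (S - T))"
      unfolding wedge_def sum_distrib_left sum_distrib_right
    proof (intro sum.cong refl)
      fix T R assume "T \<in> Pow S" "R \<in> Pow T"
      then have "wedge_sign T (S - T) = wedge_sign R (S - T) * wedge_sign (T - R) (S - T)"
        using wedge_sign_Un_left[of R "T - R" "S - T"] fin[of R] fin[of "T - R"] fin[of "S - T"]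
        by (simp add: Un_absorb1 subset_trans Diff_subset_conv le_supI2)
      then show "wedge_sign T (S - T) * (wedge_sign R (T - R) * u R * v (T - R)) * w (S - T)
          = ?f R (T - R) (S - T)" by simp
    qed
    also have "\<dots> = (\<Sum>(T, R)\<in>Sigma (Pow S) Pow. ?f R (T - R) (S - T))"
      using True by (subst sum.Sigma) (auto intro: fin)
    also have "\<dots> = (\<Sum>(R, Q)\<in>Sigma (Pow S) (\<lambda>R. Pow (S - R)). ?f R Q (S - R - Q))"
    proof (rule sum.reindex_bij_witness[of _ "\<lambda>(R, Q). (R \<union> Q, R)" "\<lambda>(T, R). (R, T - R)"], goal_cases)
      case (5 a)
      obtain T R where a: "a = (T, R)" by (cases a)
      with 5 have "S - R - (T - R) = S - T" by auto
      then show ?case by (simp add: a)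
    qed auto
    also have "\<dots> = (\<Sum>R\<in>Pow S. \<Sum>Q\<in>Pow (S - R). ?f R Q (S - R - Q))"
      using True by (subst sum.Sigma) auto
    also have "\<dots> = (u \<and>\<^sub>e (v \<and>\<^sub>e w)) S"
      unfolding wedge_def sum_distrib_left sum_distrib_right
    proof (intro sum.cong refl)
      fix R Q assume *: "R \<in> Pow S" "Q \<in> Pow (S - R)"
      then have "finite R" "finite Q" "finite (S - R - Q)" "Q \<inter> (S - R - Q) = {}"
        using True by (auto intro: finite_subset)
      moreover have "Q \<union> (S - R - Q) = S - R" using * by auto
      ultimately have "wedge_sign R (S - R) = wedge_sign R Q * wedge_sign R (S - R - Q)"
        using wedge_sign_Un_right[of R Q "S - R - Q"] by simp
      then show "?f R Q (S - R - Q)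
          = wedge_sign R (S - R) * u R * (wedge_sign Q (S - R - Q) * v Q * w (S - R - Q))" by simp
    qed
    finally show ?thesis .
  qed (simp add: wedge_infinite)
qed

lemma one_wedge: "finite S \<Longrightarrow> (unit_fun {} \<and>\<^sub>e u) S = u S"
proof -
  assume S: "finite S"
  have "(unit_fun {} \<and>\<^sub>e u) S = (\<Sum>T\<in>Pow S. if T = {} then u S else 0)"
    unfolding wedge_def by (intro sum.cong) (auto simp: unit_fun_def wedge_sign_def)
  then show ?thesis using S by simp
qed

lemma wedge_ext_power:
  assumes "finite B" "u \<in> ext_power m (fun_space B)" "v \<in> ext_power n (fun_space B)"
  shows "u \<and>\<^sub>e v \<in> ext_power (m + n) (fun_space B)"
proof -
  have u: "\<And>T. u T \<noteq> 0 \<Longrightarrow> T \<subseteq> B \<and> card T = m"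
    and v: "\<And>T. v T \<noteq> 0 \<Longrightarrow> T \<subseteq> B \<and> card T = n"
    using assms(2,3) unfolding ext_power_eq[OF assms(1)] unfolding fun_space_def by blast+
  have "(u \<and>\<^sub>e v) S = 0" if S: "\<not> (S \<subseteq> B \<and> card S = m + n)" for S
  proof (cases "finite S")
    case True
    have "u T = 0 \<or> v (S - T) = 0" if T: "T \<subseteq> S" for T
    proof (rule ccontr)
      assume *: "\<not> ?thesis"
      then have "T \<subseteq> B \<and> card T = m" "S - T \<subseteq> B \<and> card (S - T) = n"
        using u v by auto
      moreover have "card S = card T + card (S - T)"
        using True T by (simp add: card_Diff_subset card_mono finite_subset)
      ultimately show False using S by auto
    qed
    then show ?thesis unfolding wedge_def by (intro sum.neutral) auto
  qed (simp add: wedge_infinite)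
  then show ?thesis unfolding ext_power_eq[OF assms(1)] unfolding fun_space_def by blast
qed

lemma cayley_form_in_ext_power: "cayley_form d k \<in> ext_power k (tensor_power d k)"
proof -
  have "wedge_list (map (\<lambda>i. tensor (map (\<lambda>j. unit_fun (\<pi> j i)) [1..<Suc d])) [1..<Suc k])
      \<in> {wedge_list xs | xs. length xs = k \<and> set xs \<subseteq> tensor_power d k}"
    if \<pi>: "\<pi> \<in> {1..d} \<rightarrow>\<^sub>E {p. p permutes {1..k}}" for \<pi> :: "nat \<Rightarrow> nat \<Rightarrow> nat"
  proof -
    have "tensor (map (\<lambda>j. unit_fun (\<pi> j i)) [1..<Suc d]) \<in> tensor_power d k"
      if i: "i \<in> {1..k}" for i
    proof -
      have "unit_fun (\<pi> j i) \<in> fun_space {1..k}" if "j \<in> {1..d}" for j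
      proof -
        have "\<pi> j permutes {1..k}" using PiE_mem[OF \<pi> that] by simp
        then have "\<pi> j i \<in> {1..k}" using i permutes_in_image by metis
        then show ?thesis by (auto simp: fun_space_def unit_fun_def)
      qed
      then have "set (map (\<lambda>j. unit_fun (\<pi> j i)) [1..<Suc d]) \<subseteq> fun_space {1..k}"
        unfolding set_map set_upt atLeastLessThanSuc_atLeastAtMost by blast
      moreover have "length (map (\<lambda>j. unit_fun (\<pi> j i)) [1..<Suc d]) = d"
        by (simp only: length_map length_upt diff_Suc_1 One_nat_def)
      ultimately show ?thesis
        unfolding tensor_power_def by (intro cfun.span_base) blast
    qed
    then have "set (map (\<lambda>i. tensor (map (\<lambda>j. unit_fun (\<pi> j i)) [1..<Suc d])) [1..<Suc k])
        \<subseteq> tensor_power d k"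
      unfolding set_map set_upt atLeastLessThanSuc_atLeastAtMost by blast
    moreover have "length (map (\<lambda>i. tensor (map (\<lambda>j. unit_fun (\<pi> j i)) [1..<Suc d])) [1..<Suc k]) = k"
      by (simp only: length_map length_upt diff_Suc_1 One_nat_def)
    ultimately show ?thesis by blast
  qed
  then show ?thesis
    unfolding cayley_form_def ext_power_def
    by (intro cfun.span_sum cfun.span_scale cfun.span_base)
qed

end

theory Submission
  imports Defs
begin

text \<open>Let \<open>H\<close> be the slice of basis tensors whose first index is \<open>1\<close>; it has \<open>k ^ (d - 1)\<close> elements.
  Every basis element \<open>e\<^sub>T\<close> occurring in \<open>\<omega>\<close> involves a member of \<open>H\<close>, because \<open>\<pi>\<^sub>1\<close> is
  surjective.  Hence \<open>\<omega> \<and> e\<^sub>H = 0\<close>, and no \<open>e\<^sub>S\<close> with \<open>S\<close> disjoint from \<open>H\<close> occurs in any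
  \<open>\<omega> \<and> v\<close>.  For \<open>n = k ^ (d - 1)\<close> the first fact refutes injectivity, and the second one refutes
  surjectivity as soon as \<open>n + k \<le> k ^ d - k ^ (d - 1)\<close>, which holds since \<open>k > 2\<close>.\<close>

lemma unit_fun_in_fun_space: "b \<in> B \<Longrightarrow> unit_fun b \<in> fun_space B"
  by (auto simp: unit_fun_def fun_space_def)

lemma inj_unit_fun: "inj unit_fun"
proof (rule injI)
  fix a b :: 'a assume "unit_fun a = unit_fun b"
  then have "unit_fun a a = unit_fun b a" by simp
  then show "a = b" by (simp add: unit_fun_def split: if_splits)
qed

lemma independent_unit_fun: "\<not> cfun.dependent (unit_fun ` B)"
proof
  assume "cfun.dependent (unit_fun ` B)"
  then obtain b where "b \<in> B" and "unit_fun b \<in> cfun.span (unit_fun ` B - {unit_fun b})"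
    unfolding cfun.dependent_def by blast
  \<comment> \<open>All remaining generators vanish at \<open>b\<close>, a condition closed under
    linear combinations, whereas \<open>unit_fun b\<close> takes the value 1 there.\<close>
  moreover have "cfun.span (unit_fun ` B - {unit_fun b}) \<subseteq> fun_space (- {b})"
    by (rule cfun.span_minimal[OF _ subspace_fun_space]) (auto simp: unit_fun_def fun_space_def)
  ultimately have "unit_fun b \<in> fun_space (- {b})" by blast
  then show False by (simp add: unit_fun_def fun_space_def)
qed

lemma dim_fun_space:
  assumes "finite B"
  shows "cfun.dim (fun_space B) = card B"
proof -
  have "cfun.dim (fun_space B) = card (unit_fun ` B)"
    unfolding span_unit_fun[OF assms, symmetric]
    by (rule cfun.dim_span_eq_card_independent[OF independent_unit_fun])
  also have "\<dots> = card B"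
    by (rule card_image) (rule inj_on_subset[OF inj_unit_fun subset_UNIV])
  finally show ?thesis .
qed

text \<open>The killed basis vector at \<open>a\<close> pushes the rank below the dimension of the
  source, and the missing coordinate \<open>b\<close> pushes it below that of the target. Full rank
  fails only if both happen, since it means equality with the minimum.\<close>

lemma not_full_rank:
  assumes "Vector_Spaces.linear fscale fscale f" and "finite A" "finite B"
    and "a \<in> A" "f (unit_fun a) = 0"
    and "b \<in> B" "f ` fun_space A \<subseteq> fun_space (B - {b})"
  shows "\<not> full_rank f (fun_space A) (fun_space B)"
proof -
  interpret f: Vector_Spaces.linear fscale fscale f by fact
  have "f ` fun_space A = cfun.span (f ` unit_fun ` A)"
    using assms(2) by (simp add: span_unit_fun[symmetric] f.span_image)
  also have "f ` unit_fun ` A = insert 0 (f ` unit_fun ` (A - {a}))"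
    using assms(4,5) by (auto simp: image_iff) 
  also have "cfun.span \<dots> = cfun.span (f ` unit_fun ` (A - {a}))"
    by simp
  finally have "cfun.dim (f ` fun_space A) \<le> card (f ` unit_fun ` (A - {a}))"
    using assms(2) by (intro cfun.dim_le_card) auto
  also have "\<dots> \<le> card (A - {a})"
    using assms(2) by (simp add: image_image card_image_le)
  also have "\<dots> < card A"
    using assms(2,4) by (rule card_Diff1_less)
  finally have 1: "cfun.dim (f ` fun_space A) < cfun.dim (fun_space A)"
    using assms(2) by (simp add: dim_fun_space)
  have "cfun.dim (f ` fun_space A) \<le> card (unit_fun ` (B - {b}))"
    using assms(3,7) by (intro cfun.dim_le_card) (auto simp: span_unit_fun)
  also have "\<dots> \<le> card (B - {b})"
    using assms(3) by (simp add: card_image_le)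
  also have "\<dots> < card B"
    using assms(3,6) by (rule card_Diff1_less)
  finally have "cfun.dim (f ` fun_space A) < cfun.dim (fun_space B)"
    using assms(3) by (simp add: dim_fun_space)
  with 1 show ?thesis by (simp add: full_rank_def)
qed

lemma linear_wedge: "Vector_Spaces.linear fscale fscale (\<lambda>v. u \<and>\<^sub>e v)"
  by unfold_locales (simp_all only: wedge_add_right wedge_scale_right)

text \<open>Left multiplication by a basis vector \<open>a\<close> reaches only sets obtained by
  adjoining \<open>a\<close>. The index lists in the Cayley form are not sorted, and only their set
  matters here, so no signs are tracked.\<close>

lemma wedge_list_unit_fun_support:
  "wedge_list (map unit_fun bs) S \<noteq> 0 \<Longrightarrow> S = set bs"
proof (induction bs arbitrary: S)
  case Nil
  then show ?case by (simp add: wedge_list_def unit_fun_def split: if_splits)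
next
  case (Cons a bs)
  have eq: "wedge_list (map unit_fun (a # bs)) = ext_vec (unit_fun a) \<and>\<^sub>e wedge_list (map unit_fun bs)"
    by (simp add: wedge_list_def)
  have "finite S"
    using Cons.prems wedge_infinite unfolding eq by blast
  then obtain b where "b \<in> S" "unit_fun a b \<noteq> 0" "wedge_list (map unit_fun bs) (S - {b}) \<noteq> 0"
    using Cons.prems unfolding eq by (auto simp: ext_vec_wedge elim!: sum.not_neutral_contains_not_neutral)
  moreover from this have "b = a" by (simp add: unit_fun_def split: if_splits)
  ultimately show ?case using Cons.IH by auto
qed

lemma cayley_form_support:
  assumes "d > 0" "k > 0" "cayley_form d k T \<noteq> 0"
  shows "T \<inter> (#) 1 ` multi_index (d - 1) k \<noteq> {}"
proof -
  let ?ix = "\<lambda>\<pi> i. map (\<lambda>j. \<pi> j i) [1..<Suc d]"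
  have t: "tensor (map (\<lambda>j. unit_fun (\<pi> j i)) [1..<Suc d]) = unit_fun (?ix \<pi> i)" for \<pi> :: "nat \<Rightarrow> 'a \<Rightarrow> nat" and i
    by (simp add: tensor_unit_fun[symmetric] comp_def del: upt_Suc)
  \<comment> \<open>A nonzero coefficient of the sum forces one nonzero summand; cancellation
    between summands can only shrink the support.\<close>
  obtain \<pi> where \<pi>: "\<pi> \<in> {1..d} \<rightarrow>\<^sub>E {p. p permutes {1..k}}"
    and "wedge_list (map (\<lambda>i. unit_fun (?ix \<pi> i)) [1..<Suc k]) T \<noteq> 0"
    using assms(3) unfolding cayley_form_def sum_fun_apply t fscale_def
    by (rule sum.not_neutral_contains_not_neutral) simp
  then have "wedge_list (map unit_fun (map (?ix \<pi>) [1..<Suc k])) T \<noteq> 0"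
    by (simp add: comp_def del: upt_Suc)
  then have T: "T = ?ix \<pi> ` {1..k}"
    by (drule_tac wedge_list_unit_fun_support) (simp add: atLeastLessThanSuc_atLeastAtMost del: upt_Suc)
  have perm: "\<pi> j permutes {1..k}" if "j \<in> {1..d}" for j
    using PiE_mem[OF \<pi> that] by simp
  have "1 \<in> \<pi> 1 ` {1..k}"
    using permutes_image[OF perm[of 1]] assms(1,2) by simp
  then obtain i where i: "i \<in> {1..k}" "\<pi> 1 i = 1" by (metis imageE)
  have "?ix \<pi> i = 1 # map (\<lambda>j. \<pi> j i) [2..<Suc d]"
    using assms(1) i(2) by (simp add: upt_conv_Cons numeral_2_eq_2 del: upt_Suc)
  moreover have "map (\<lambda>j. \<pi> j i) [2..<Suc d] \<in> multi_index (d - 1) k"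
  proof -
    have "\<pi> j i \<in> {1..k}" if "j \<in> {2..<Suc d}" for j
      using permutes_in_image[OF perm[of j]] i(1) that by auto
    then show ?thesis unfolding multi_index_def by (auto simp del: upt_Suc)
  qed
  ultimately have "?ix \<pi> i \<in> (#) 1 ` multi_index (d - 1) k"
    by (simp only: imageI)
  moreover have "?ix \<pi> i \<in> T"
    unfolding T using i(1) by (rule imageI)
  ultimately have "?ix \<pi> i \<in> T \<inter> (#) 1 ` multi_index (d - 1) k"
    by (simp only: Int_iff simp_thms)
  then show ?thesis by (intro notI) (simp only: empty_iff)
qed

text \<open>A surviving term at \<open>S\<close> needs \<open>S - T = H\<close>, making
  \<open>T\<close> disjoint from \<open>H\<close>, where \<open>u\<close> vanishes.\<close>

lemma wedge_unit_fun_eq_0: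
  assumes "\<And>T. u T \<noteq> 0 \<Longrightarrow> T \<inter> H \<noteq> {}"
  shows "u \<and>\<^sub>e unit_fun H = 0"
proof
  fix S
  have "u T = 0 \<or> unit_fun H (S - T) = 0" for T
    using assms[of T] by (auto simp: unit_fun_def)
  then have "(u \<and>\<^sub>e unit_fun H) S = 0"
    unfolding wedge_def by (intro sum.neutral ballI) (metis mult_eq_0_iff)
  then show "(u \<and>\<^sub>e unit_fun H) S = 0 S" by simp
qed

text \<open>The product at \<open>S\<close> only samples \<open>u\<close> at subsets of
  \<open>S\<close>, and all of these avoid \<open>H\<close>.\<close>

lemma wedge_eq_0_if_disjoint:
  assumes "\<And>T. u T \<noteq> 0 \<Longrightarrow> T \<inter> H \<noteq> {}" and "S \<inter> H = {}"
  shows "(u \<and>\<^sub>e v) S = 0"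
proof -
  have "u T = 0" if "T \<subseteq> S" for T
    using assms that by blast
  then show ?thesis unfolding wedge_def by (intro sum.neutral ballI) simp
qed

theorem theorem1p9:
  fixes d k :: nat and V :: "(nat list \<Rightarrow> complex) set"
    and \<omega> :: "nat list set \<Rightarrow> complex"
  defines "V \<equiv> tensor_power d k"
    and "\<omega> \<equiv> cayley_form d k"
  assumes "d \<ge> 3" and "odd d" and "k > 2"
  shows "\<not> (\<forall>n \<in> {0..k ^ d - k}. full_rank (\<lambda>v. \<omega> \<and>\<^sub>e v) (ext_power n V) (ext_power (n + k) V))
    \<and> (\<exists>n \<in> {0..k ^ d - k}.
        \<not> inj_on (\<lambda>v. \<omega> \<and>\<^sub>e v) (ext_power n V)
        \<and> (\<lambda>v. \<omega> \<and>\<^sub>e v) ` ext_power n V \<noteq> ext_power (n + k) V)"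
proof -
  define M where "M = multi_index d k"
  define H where "H = (#) (1 :: nat) ` multi_index (d - 1) k"
  define n where "n = k ^ (d - 1)"
  define A where "A = (\<lambda>m. {S. S \<subseteq> M \<and> card S = m})"
  have finM: "finite M" by (simp add: M_def finite_multi_index)
  have finA: "finite (A m)" for m
    using finM by (simp add: A_def)
  have ext: "ext_power m V = fun_space (A m)" for m
    unfolding V_def tensor_power_eq A_def M_def by (rule ext_power_eq[OF finite_multi_index])
  have cardM: "card M = k * n"
    using assms(3) by (simp add: M_def card_multi_index n_def power_eq_if)
  have cardH: "card H = n"
    by (simp add: H_def n_def card_image card_multi_index)
  have HM: "H \<subseteq> M"
    using assms(3,5) unfolding H_def M_def multi_index_def by fastforce
  have HA: "H \<in> A n" using HM cardH by (simp add: A_def)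
  have "k \<le> n"
    using assms(3,5) self_le_power[of k "d - 1"] by (simp add: n_def)
  \<comment> \<open>Here \<open>k > 2\<close> enters: with \<open>k \<le> n\<close> it gives
    \<open>n + k \<le> 2 * n \<le> k * n - n\<close>, which leaves room for a set of size
    \<open>n + k\<close> outside \<open>H\<close>.\<close>
  moreover have "3 * n \<le> k * n"
    using assms(5) by (intro mult_le_mono1) simp
  moreover have "card (M - H) = k * n - n"
    using HM finM by (simp add: card_Diff_subset finite_subset cardM cardH)
  ultimately have le: "n + k \<le> card (M - H)" "n + k \<le> k * n" by linarith+
  then have n: "n \<in> {0..k ^ d - k}"
    using cardM by (simp add: M_def card_multi_index)
  obtain S where S: "S \<subseteq> M - H" "card S = n + k"
    using le(1) by (metis obtain_subset_with_card_n)
  then have SA: "S \<in> A (n + k)" and SH: "S \<inter> H = {}" by (auto simp: A_def)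
  have supp: "\<omega> T \<noteq> 0 \<Longrightarrow> T \<inter> H \<noteq> {}" for T
    unfolding \<omega>_def H_def by (rule cayley_form_support) (use assms in auto)
  have kill: "\<omega> \<and>\<^sub>e unit_fun H = 0"
    using supp by (rule wedge_unit_fun_eq_0)
  have miss: "(\<omega> \<and>\<^sub>e v) S = 0" for v
    using supp SH by (rule wedge_eq_0_if_disjoint)
  \<comment> \<open>\<open>miss\<close> handles only the coordinate \<open>S\<close>; the degree
    count handles all sets outside \<open>A (n + k)\<close>.\<close>
  have "\<omega> \<and>\<^sub>e v \<in> fun_space (A (n + k))" if "v \<in> fun_space (A n)" for v
    using wedge_ext_power[OF finite_multi_index, of \<omega> k d k v n] cayley_form_in_ext_power[of d k] that
    unfolding ext[symmetric] V_def \<omega>_def tensor_power_eq by (simp add: add.commute)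
  with miss have img: "(\<lambda>v. \<omega> \<and>\<^sub>e v) ` fun_space (A n) \<subseteq> fun_space (A (n + k) - {S})"
    by (auto simp: fun_space_def)
  have "\<not> full_rank (\<lambda>v. \<omega> \<and>\<^sub>e v) (ext_power n V) (ext_power (n + k) V)"
    unfolding ext by (rule not_full_rank[OF linear_wedge finA finA HA kill SA img])
  moreover have "\<not> inj_on (\<lambda>v. \<omega> \<and>\<^sub>e v) (ext_power n V)"
  proof
    assume "inj_on (\<lambda>v. \<omega> \<and>\<^sub>e v) (ext_power n V)"
    \<comment> \<open>The nonzero vector \<open>unit_fun H\<close> and the zero vector have the same
      image.\<close>
    moreover have "\<omega> \<and>\<^sub>e unit_fun H = \<omega> \<and>\<^sub>e 0"
      unfolding kill by (auto simp: wedge_def)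
    moreover have "0 \<in> ext_power n V"
      unfolding ext by (simp add: fun_space_def)
    ultimately have "unit_fun H = (0 :: nat list set \<Rightarrow> complex)"
      using unit_fun_in_fun_space[OF HA] unfolding ext by (blast dest: inj_onD)
    then have "unit_fun H H = (0 :: complex)" by simp
    then show False by (simp add: unit_fun_def)
  qed
  moreover have "(\<lambda>v. \<omega> \<and>\<^sub>e v) ` ext_power n V \<noteq> ext_power (n + k) V"
  proof
    assume "(\<lambda>v. \<omega> \<and>\<^sub>e v) ` ext_power n V = ext_power (n + k) V"
    with img have "unit_fun S \<in> fun_space (A (n + k) - {S})"
      using unit_fun_in_fun_space[OF SA] unfolding ext by blast
    then show False by (auto simp: unit_fun_def fun_space_def)
  qed
  ultimately show ?thesis using n by blast
qed

end
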